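(* For every finite or countably infinite set $S$ and every $\sigma$-finite measure $\nu$ on $\mathcal{P}(S)\setminus\{\emptyset\}$, the (law of the) process $X^\nu$ has the downward FKG property. However, $X^\nu$ does not necessarily satisfy the FKG property, i.e. there exist $S$ and $\nu$ such that $X^\nu$ does not satisfy the FKG property.
   Context: Let $S$ be a finite or countably infinite set, and identify the power set $\mathcal{P}(S)$ with $\{0,1\}^S$ (product topology, Borel $\sigma$-algebra). For a $\sigma$-finite measure $\nu$ on $\mathcal{P}(S)\setminus\{\emptyset\}$, let $Y^\nu=\{B_j\}_{j\in I}$ be the Poisson process on $\mathcal{P}(S)\setminus\{\emptyset\}$ with intensity measure $\nu$ (a random collection, possibly with repetitions, of nonempty subsets of $S$). Define the $\{0,1\}$-valued process $X^\nu=(X^\nu_i)_{i\in S}$ by $X^\nu_i=1$ if $i\in\bigcup_{j\in I}B_j$ and $X^\nu_i=0$ otherwise. A probability measure $\mu$ on $\{0,1\}^S$ is positively associated if $\mu(A\cap B)\ge\mu(A)\mu(B)$ for all increasing (measurable) sets $A,B$. It satisfies the FKG property if for all $I\subseteq S$ and all $\{a_i\}_{i\in I}$ with $a_i\in\{0,1\}$ such that $\mu(X_i=a_i \text{ for } i\in I)>0$, the conditional measure $\mu(\cdot\mid X_i=a_i\text{ for }i\in I)$ on $\{0,1\}^{S\setminus I}$ is positively associated. It satisfies the downward FKG property if this is required only when all $a_i=0$. *)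

theory Defs
  imports "HOL-Probability.Probability"
begin

(* {0,1}^S. For countable S the product sigma-algebra is the Borel sigma-algebra of the
   product topology. *)
definition config_space :: "'a set \<Rightarrow> ('a \<Rightarrow> nat) measure" where
  "config_space S = PiM S (\<lambda>_. count_space {0, 1})"

(* P(S) - {{}}, with the trace of the sigma-algebra of {0,1}^S under the identification of a
   subset of S with its indicator function. *)
definition nonempty_subsets :: "'a set \<Rightarrow> 'a set measure" where
  "nonempty_subsets S =
     vimage_algebra (Pow S - {{}}) (\<lambda>B. restrict (indicator B) S) (config_space S)"

(* A random collection of points is an indexed family: in the outcome w it consists of the points
   B j w with j in J w. Distinct indices may carry the same point, so repetitions are allowed.
   num_points J B A w counts the points in A with multiplicity. *)
definition num_points ::
    "('w \<Rightarrow> 'j set) \<Rightarrow> ('j \<Rightarrow> 'w \<Rightarrow> 'b) \<Rightarrow> 'b set \<Rightarrow> 'w \<Rightarrow> ennreal" where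
  "num_points J B A w = emeasure (count_space UNIV) {j \<in> J w. B j w \<in> A}"

(* Poisson process with intensity measure \<nu>, realised on the probability space M: the number of
   points in A is Poisson distributed with parameter \<nu>(A) (almost surely infinite if
   \<nu>(A) is infinite, 0 if \<nu>(A) = 0), and the numbers of points in finitely many disjoint
   sets are independent. The Poisson weights are written out because poisson_pmf requires a
   strictly positive rate. *)
definition poisson_process ::
    "'w measure \<Rightarrow> 'b measure \<Rightarrow> ('w \<Rightarrow> 'j set) \<Rightarrow> ('j \<Rightarrow> 'w \<Rightarrow> 'b) \<Rightarrow> bool" where
  "poisson_process M \<nu> J B \<longleftrightarrow>
     prob_space M \<and>
     (\<forall>w\<in>space M. \<forall>j\<in>J w. B j w \<in> space \<nu>) \<and>
     (\<forall>A\<in>sets \<nu>. num_points J B A \<in> borel_measurable M) \<and>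
     (\<forall>A\<in>sets \<nu>. emeasure \<nu> A < \<infinity> \<longrightarrow>
        (\<forall>k::nat. measure M {w\<in>space M. num_points J B A w = of_nat k} =
           measure \<nu> A ^ k / fact k * exp (- measure \<nu> A))) \<and>
     (\<forall>A\<in>sets \<nu>. emeasure \<nu> A = \<infinity> \<longrightarrow> (AE w in M. num_points J B A w = \<infinity>)) \<and>
     (\<forall>(n::nat) A. (\<forall>k<n. A k \<in> sets \<nu>) \<longrightarrow> disjoint_family_on A {..<n} \<longrightarrow>
        prob_space.indep_vars M (\<lambda>_. borel) (\<lambda>k. num_points J B (A k)) {..<n})"

definition covered :: "('w \<Rightarrow> 'j set) \<Rightarrow> ('j \<Rightarrow> 'w \<Rightarrow> 'a set) \<Rightarrow> 'a \<Rightarrow> 'w \<Rightarrow> nat" where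
  "covered J B i w = (if i \<in> (\<Union>j\<in>J w. B j w) then 1 else 0)"

definition covered_law ::
    "'a set \<Rightarrow> 'w measure \<Rightarrow> ('w \<Rightarrow> 'j set) \<Rightarrow> ('j \<Rightarrow> 'w \<Rightarrow> 'a set) \<Rightarrow> ('a \<Rightarrow> nat) measure" where
  "covered_law S M J B = distr M (config_space S) (\<lambda>w. \<lambda>i\<in>S. covered J B i w)"

definition increasing_event :: "'a set \<Rightarrow> ('a \<Rightarrow> nat) set \<Rightarrow> bool" where
  "increasing_event S A \<longleftrightarrow>
     A \<in> sets (config_space S) \<and>
     (\<forall>x\<in>A. \<forall>y\<in>space (config_space S). (\<forall>i\<in>S. x i \<le> y i) \<longrightarrow> y \<in> A)"

definition positively_associated :: "'a set \<Rightarrow> ('a \<Rightarrow> nat) measure \<Rightarrow> bool" where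
  "positively_associated S \<mu> \<longleftrightarrow>
     (\<forall>A B. increasing_event S A \<longrightarrow> increasing_event S B \<longrightarrow>
        measure \<mu> (A \<inter> B) \<ge> measure \<mu> A * measure \<mu> B)"

definition agree_event :: "'a set \<Rightarrow> 'a set \<Rightarrow> ('a \<Rightarrow> nat) \<Rightarrow> ('a \<Rightarrow> nat) set" where
  "agree_event S I a = {x \<in> space (config_space S). \<forall>i\<in>I. x i = a i}"

(* The conditional measure lives on {0,1}^(S - I): condition, then forget the coordinates in I. *)
definition cond_law ::
    "'a set \<Rightarrow> ('a \<Rightarrow> nat) measure \<Rightarrow> 'a set \<Rightarrow> ('a \<Rightarrow> nat) \<Rightarrow> ('a \<Rightarrow> nat) measure" where
  "cond_law S \<mu> I a =
     distr (uniform_measure \<mu> (agree_event S I a)) (config_space (S - I)) (\<lambda>x. restrict x (S - I))"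

definition FKG :: "'a set \<Rightarrow> ('a \<Rightarrow> nat) measure \<Rightarrow> bool" where
  "FKG S \<mu> \<longleftrightarrow>
     (\<forall>I a. I \<subseteq> S \<longrightarrow> (\<forall>i\<in>I. a i \<in> {0, 1}) \<longrightarrow> measure \<mu> (agree_event S I a) > 0 \<longrightarrow>
        positively_associated (S - I) (cond_law S \<mu> I a))"

definition downward_FKG :: "'a set \<Rightarrow> ('a \<Rightarrow> nat) measure \<Rightarrow> bool" where
  "downward_FKG S \<mu> \<longleftrightarrow>
     (\<forall>I. I \<subseteq> S \<longrightarrow> measure \<mu> (agree_event S I (\<lambda>_. 0)) > 0 \<longrightarrow>
        positively_associated (S - I) (cond_law S \<mu> I (\<lambda>_. 0)))"

end

theory Submission
  imports Defs
begin

text \<open>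
  Given that no point of the process hits \<open>I\<close>, the counts of the points with a given nonempty trace on
  a finite set \<open>F\<close> are independent, and \<open>X\<close> restricted to \<open>F\<close> is an increasing function of the
  indicators that these counts are positive. Harris' inequality for independent Bernoulli variables
  then gives the correlation inequality for increasing events depending on \<open>F\<close>. General increasing
  events are approximated from inside: by inner regularity they contain a compact set of almost full
  measure, and the increasing cylinders generated by it decrease, by compactness, into the event.

  FKG fails for independent Poisson numbers of copies of \<open>{0, 1}\<close> and \<open>{0, 2}\<close>: given \<open>X 0 = 1\<close>, at
  least one of the two sets is present, which makes \<open>X 1\<close> and \<open>X 2\<close> negatively correlated.
\<close>

section \<open>Harris' inequality\<close>

text \<open>The expectation of \<open>f\<close> at a random subset of \<open>K\<close> that contains
  each \<open>c\<close> independently with probability \<open>p c\<close>, when all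
  \<open>p c\<close> lie between 0 and 1.\<close>

definition bernoulli_mean :: "('k \<Rightarrow> real) \<Rightarrow> 'k set \<Rightarrow> ('k set \<Rightarrow> real) \<Rightarrow> real" where
  "bernoulli_mean p K f = (\<Sum>V\<in>Pow K. (\<Prod>c\<in>V. p c) * (\<Prod>c\<in>K - V. 1 - p c) * f V)"

text \<open>Splits the subsets according to whether they contain \<open>k\<close>; this conditioning
  on one coordinate drives the induction for \<open>harris_inequality\<close>.\<close>

lemma bernoulli_mean_insert:
  assumes "finite K" "k \<notin> K"
  shows "bernoulli_mean p (insert k K) f =
    p k * bernoulli_mean p K (\<lambda>V. f (insert k V)) + (1 - p k) * bernoulli_mean p K f"
proof -
  let ?w = "\<lambda>K V. (\<Prod>c\<in>V. p c) * (\<Prod>c\<in>K - V. 1 - p c)"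
  have fin: "finite V" if "V \<in> Pow K" for V
    using that assms finite_subset by auto
  have inj: "inj_on (insert k) (Pow K)"
    using assms by (auto simp: inj_on_def)
  have "bernoulli_mean p (insert k K) f =
      (\<Sum>V\<in>Pow K. ?w (insert k K) V * f V) + (\<Sum>V\<in>insert k ` Pow K. ?w (insert k K) V * f V)"
    unfolding bernoulli_mean_def Pow_insert using assms
    by (intro sum.union_disjoint) auto
  also have "(\<Sum>V\<in>insert k ` Pow K. ?w (insert k K) V * f V) =
      (\<Sum>V\<in>Pow K. ?w (insert k K) (insert k V) * f (insert k V))"
    using inj by (simp add: sum.reindex)
  also have "\<dots> = (\<Sum>V\<in>Pow K. p k * (?w K V * f (insert k V)))"
  proof (rule sum.cong)
    fix V assume V: "V \<in> Pow K"
    have "insert k K - insert k V = K - V" using assms V by auto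
    with V fin[OF V] assms show "?w (insert k K) (insert k V) * f (insert k V) =
        p k * (?w K V * f (insert k V))"
      by (subst prod.insert) auto
  qed simp
  also have "(\<Sum>V\<in>Pow K. ?w (insert k K) V * f V) = (\<Sum>V\<in>Pow K. (1 - p k) * (?w K V * f V))"
  proof (rule sum.cong)
    fix V assume V: "V \<in> Pow K"
    have "insert k K - V = insert k (K - V)" using assms V by auto
    with V assms show "?w (insert k K) V * f V = (1 - p k) * (?w K V * f V)"
      by simp
  qed simp
  finally show ?thesis
    by (simp add: bernoulli_mean_def sum_distrib_left)
qed

lemma bernoulli_mean_mono:
  assumes "\<And>c. c \<in> K \<Longrightarrow> 0 \<le> p c \<and> p c \<le> 1" "\<And>V. V \<subseteq> K \<Longrightarrow> f V \<le> g V"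
  shows "bernoulli_mean p K f \<le> bernoulli_mean p K g"
  unfolding bernoulli_mean_def
  using assms by (intro sum_mono mult_left_mono mult_nonneg_nonneg prod_nonneg) auto

text \<open>Induction over the coordinates. Conditionally on whether \<open>k\<close> is chosen, the
  induction hypothesis applies to both sections; what remains is the two-point case for the
  conditional means, which increase when \<open>k\<close> is added.\<close>

lemma harris_inequality:
  assumes "finite K" and p: "\<And>c. c \<in> K \<Longrightarrow> 0 \<le> p c \<and> p c \<le> 1"
    and "\<And>U V. U \<subseteq> V \<Longrightarrow> V \<subseteq> K \<Longrightarrow> f U \<le> f V" "\<And>U V. U \<subseteq> V \<Longrightarrow> V \<subseteq> K \<Longrightarrow> g U \<le> g V"
  shows "bernoulli_mean p K f * bernoulli_mean p K g \<le> bernoulli_mean p K (\<lambda>V. f V * g V)"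
  using assms
proof (induction K arbitrary: f g rule: finite_induct)
  case empty
  then show ?case by (simp add: bernoulli_mean_def)
next
  case (insert k K)
  have pk: "0 \<le> p k" "p k \<le> 1" and pK: "\<And>c. c \<in> K \<Longrightarrow> 0 \<le> p c \<and> p c \<le> 1"
    using insert.prems(1) by auto
  let ?E = "bernoulli_mean p K"
  let ?f1 = "\<lambda>V. f (insert k V)" and ?g1 = "\<lambda>V. g (insert k V)"
  have f1: "?E ?f1 * ?E ?g1 \<le> ?E (\<lambda>V. ?f1 V * ?g1 V)"
    using insert.prems by (intro insert.IH) (auto intro!: insert.prems insert_mono)
  have f0: "?E f * ?E g \<le> ?E (\<lambda>V. f V * g V)"
    using insert.prems(1) by (intro insert.IH) (blast intro: insert.prems)+
  have df: "?E f \<le> ?E ?f1" and dg: "?E g \<le> ?E ?g1"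
    using insert.prems pK by (auto intro!: bernoulli_mean_mono insert.prems)
  \<comment> \<open>This product is exactly the right side minus the left side of the next
    inequality.\<close>
  have "0 \<le> p k * (1 - p k) * ((?E ?f1 - ?E f) * (?E ?g1 - ?E g))"
    using pk df dg by simp
  then have "(p k * ?E ?f1 + (1 - p k) * ?E f) * (p k * ?E ?g1 + (1 - p k) * ?E g)
      \<le> p k * (?E ?f1 * ?E ?g1) + (1 - p k) * (?E f * ?E g)"
    by (simp add: algebra_simps)
  also have "\<dots> \<le> p k * ?E (\<lambda>V. ?f1 V * ?g1 V) + (1 - p k) * ?E (\<lambda>V. f V * g V)"
    using pk f1 f0 by (intro add_mono mult_left_mono) auto
  finally show ?case
    using insert.hyps by (simp add: bernoulli_mean_insert)
qed

section \<open>Reduction to finitely many coordinates\<close>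

lemma space_config_space: "space (config_space S) = S \<rightarrow>\<^sub>E {0, 1}"
  by (simp add: config_space_def space_PiM)

lemma measurable_config_coordinate:
  "i \<in> S \<Longrightarrow> (\<lambda>x. x i) \<in> measurable (config_space S) (count_space UNIV)"
  unfolding config_space_def
  by (rule measurable_compose[OF measurable_component_singleton]) auto

lemma sets_coordinate:
  "i \<in> S \<Longrightarrow> {x \<in> space (config_space S). x i = c} \<in> sets (config_space S)"
  using measurable_sets[OF measurable_config_coordinate, of i S "{c}"]
  by (simp add: vimage_def Int_def conj_commute)

lemma measurable_config_spaceI:
  assumes "\<And>x. x \<in> space M \<Longrightarrow> f x \<in> S \<rightarrow>\<^sub>E {0, 1}"
    and "\<And>i. i \<in> S \<Longrightarrow> {x \<in> space M. f x i = 1} \<in> sets M"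
  shows "f \<in> measurable M (config_space S)"
  unfolding config_space_def
proof (rule measurable_PiM_single')
  show "f \<in> space M \<rightarrow> (\<Pi>\<^sub>E i\<in>S. space (count_space {0, 1}))"
    using assms(1) by simp
  fix i assume i: "i \<in> S"
  have 1: "(\<lambda>x. f x i) -` {1} \<inter> space M \<in> sets M"
    using assms(2)[OF i] by (simp add: vimage_def Int_def conj_commute)
  have "(\<lambda>x. f x i) -` {0} \<inter> space M = space M - ((\<lambda>x. f x i) -` {1} \<inter> space M)"
    using assms(1) i by fastforce
  then have 0: "(\<lambda>x. f x i) -` {0} \<inter> space M \<in> sets M"
    using 1 by simp
  show "(\<lambda>x. f x i) \<in> measurable M (count_space {0, 1})"
    by (subst measurable_count_space_eq2) (use 0 1 PiE_mem[OF assms(1) i] in auto)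
qed

text \<open>Comparing on \<open>F\<close> alone makes such a set depend only on the coordinates in
  \<open>F\<close>, since two configurations that agree on \<open>F\<close> compare both ways. For
  finite \<open>F \<subseteq> S\<close> measurability is then automatic
  (\<open>increasing_on_sets\<close>).\<close>

definition increasing_on :: "'a set \<Rightarrow> 'a set \<Rightarrow> ('a \<Rightarrow> nat) set \<Rightarrow> bool" where
  "increasing_on S F A \<longleftrightarrow> A \<subseteq> space (config_space S) \<and>
     (\<forall>x\<in>A. \<forall>y\<in>space (config_space S). (\<forall>i\<in>F. x i \<le> y i) \<longrightarrow> y \<in> A)"

lemma increasing_on_mono: "increasing_on S F A \<Longrightarrow> F \<subseteq> G \<Longrightarrow> increasing_on S G A"
  unfolding increasing_on_def by blast

lemma increasing_on_Int: "increasing_on S F A \<Longrightarrow> increasing_on S F B \<Longrightarrow> increasing_on S F (A \<inter> B)"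
  unfolding increasing_on_def by blast

text \<open>\<open>A\<close> is the union of the cylinders over its restrictions to
  \<open>F\<close>, and there are only finitely many of these.\<close>

lemma increasing_on_sets:
  assumes "increasing_on S F A" "finite F" "F \<subseteq> S"
  shows "A \<in> sets (config_space S)"
proof -
  let ?P = "(\<lambda>x. restrict x F) ` A"
  have sub: "A \<subseteq> S \<rightarrow>\<^sub>E {0, 1}"
    using assms by (auto simp: increasing_on_def space_config_space)
  have "?P \<subseteq> F \<rightarrow>\<^sub>E {0, 1}"
    using sub assms(3) by (fastforce simp: PiE_iff extensional_def)
  then have fin: "finite ?P"
    by (rule finite_subset) (simp add: finite_PiE assms)
  have "A = (\<Union>p\<in>?P. {x \<in> space (config_space S). \<forall>i\<in>F. x i = p i})"
  proof safe
    fix x assume "x \<in> A"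
    then show "x \<in> (\<Union>p\<in>?P. {x \<in> space (config_space S). \<forall>i\<in>F. x i = p i})"
      using subsetD[OF sub] by (intro UN_I[of "restrict x F"]) (simp_all add: space_config_space)
  next
    fix x y assume "x \<in> space (config_space S)" "y \<in> A" "\<forall>i\<in>F. x i = restrict y F i"
    then show "x \<in> A"
      using assms(1) unfolding increasing_on_def by auto
  qed
  moreover have "{x \<in> space (config_space S). \<forall>i\<in>F. x i = p i} \<in> sets (config_space S)" for p
    using assms(2,3) by (intro sets.sets_Collect_finite_All) (auto intro: sets_coordinate)
  ultimately show ?thesis
    using \<open>finite ?P\<close> by (metis (no_types, lifting) sets.finite_UN)
qed

text \<open>Inner regularity yields a compact \<open>K\<close> inside \<open>A\<close> losing at
  most \<open>e\<close>. \<open>D n\<close> is the upward closure of \<open>K\<close> as seen by the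
  first \<open>n\<close> coordinates. It contains \<open>K\<close>, and by compactness the
  intersection of all \<open>D n\<close> contains only configurations above some point of
  \<open>K\<close>. To use \<open>inner_regular\<close>, the measure is carried over to real
  sequences.\<close>

lemma increasing_event_inner_approx:
  assumes S: "countable S" and fin: "finite_measure \<mu>" and sets: "sets \<mu> = sets (config_space S)"
    and A: "increasing_event S A" and e: "e > 0"
  obtains F D where "\<And>n. finite (F n)" "\<And>n. F n \<subseteq> S"
    "\<And>n. increasing_on S (F n) (D n)" "decseq D" "(\<Inter>n. D n) \<subseteq> A"
    "\<And>n. measure \<mu> A - e \<le> measure \<mu> (D n)"
proof -
  interpret finite_measure \<mu> by fact
  have sp: "space \<mu> = S \<rightarrow>\<^sub>E {0, 1}"
    using sets_eq_imp_space_eq[OF sets] by (simp add: space_config_space)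
  let ?idx = "to_nat_on S"
  define \<phi> :: "('a \<Rightarrow> nat) \<Rightarrow> nat \<Rightarrow> real" where
    "\<phi> x k = (if k \<in> ?idx ` S then real (x (from_nat_into S k)) else 0)" for x k
  define \<psi> :: "(nat \<Rightarrow> real) \<Rightarrow> 'a \<Rightarrow> nat" where
    "\<psi> z = (\<lambda>i\<in>S. if z (?idx i) > 0 then 1 else 0)" for z
  have \<phi>_idx: "\<phi> x (?idx i) = real (x i)" if "i \<in> S" for x i
    using that S by (auto simp: \<phi>_def)
  have \<psi>_\<phi>: "\<psi> (\<phi> x) = x" if "x \<in> space \<mu>" for x
    using that by (auto simp: \<psi>_def \<phi>_idx sp fun_eq_iff PiE_iff extensional_def)
  have from_in: "from_nat_into S k \<in> S" if "k \<in> ?idx ` S" for k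
    using that by (metis empty_iff from_nat_into image_is_empty)
  have \<phi>_meas: "\<phi> \<in> measurable \<mu> borel"
  proof (rule measurable_coordinatewise_then_product)
    fix k
    have "(\<lambda>x. real (x i)) \<in> borel_measurable \<mu>" if "i \<in> S" for i
      using measurable_compose[OF measurable_config_coordinate[OF that], of real borel]
      by (simp add: measurable_cong_sets[OF sets refl])
    then show "(\<lambda>x. \<phi> x k) \<in> borel_measurable \<mu>"
      using from_in[of k] by (cases "k \<in> ?idx ` S") (auto simp: \<phi>_def)
  qed
  have \<psi>_meas: "\<psi> \<in> measurable borel (config_space S)"
    by (rule measurable_config_spaceI) (auto simp: \<psi>_def split: if_splits)
  define \<mu>' where "\<mu>' = distr \<mu> borel \<phi>"
  interpret \<mu>': finite_measure \<mu>'
    unfolding \<mu>'_def by (rule finite_measure_distr[OF \<phi>_meas])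
  have A_sets: "A \<in> sets (config_space S)" and A_space: "A \<subseteq> space \<mu>"
    using A sets.sets_into_space[of A "config_space S"] sets_eq_imp_space_eq[OF sets]
    by (auto simp: increasing_event_def)
  \<comment> \<open>A preimage under \<open>\<psi>\<close> is Borel at once, and since
    \<open>\<psi>\<close> undoes \<open>\<phi>\<close>, pulling it back along \<open>\<phi>\<close>
    returns \<open>A\<close>.\<close>
  define A' where "A' = \<psi> -` A"
  have A'_sets: "A' \<in> sets borel"
    using measurable_sets[OF \<psi>_meas A_sets] by (simp add: A'_def)
  have A'_eq: "\<phi> -` A' \<inter> space \<mu> = A"
    using A_space \<psi>_\<phi> by (auto simp: A'_def)
  obtain K where K: "K \<subseteq> A'" "compact K" "measure \<mu> A - e \<le> measure \<mu>' K"
  proof -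
    have m: "measure \<mu>' A' = measure \<mu> A"
      unfolding \<mu>'_def by (subst measure_distr[OF \<phi>_meas A'_sets]) (simp add: A'_eq)
    show thesis
    \<comment> \<open>A nonnegative bound passes to \<open>ennreal\<close> faithfully; a negative
      one is met by the empty set.\<close>
    proof (cases "measure \<mu> A - e \<ge> 0")
      case True
      then have "ennreal (measure \<mu> A - e) < emeasure \<mu>' A'"
        using e by (simp add: \<mu>'.emeasure_eq_measure m ennreal_less_iff)
      also have "emeasure \<mu>' A' = (SUP K\<in>{K. K \<subseteq> A' \<and> compact K}. emeasure \<mu>' K)"
        using A'_sets \<mu>'.emeasure_finite[of "space \<mu>'"]
        by (intro inner_regular) (simp_all add: \<mu>'_def)
      finally obtain K where "K \<subseteq> A'" "compact K" "ennreal (measure \<mu> A - e) < emeasure \<mu>' K"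
        by (auto simp: less_SUP_iff)
      then show thesis
        using True by (intro that[of K]) (auto simp: \<mu>'.emeasure_eq_measure ennreal_less_iff)
    next
      case False
      then show thesis
        by (intro that[of "{}"]) auto
    qed
  qed
  define F where "F n = {i \<in> S. ?idx i < n}" for n
  define D where "D n = {x \<in> space \<mu>. \<exists>z\<in>K. \<forall>k<n. z k \<le> \<phi> x k}" for n
  have sub: "\<phi> -` K \<inter> space \<mu> \<subseteq> D n" for n
    by (auto simp: D_def)
  have inc: "increasing_on S (F n) (D n)" for n
    unfolding increasing_on_def
  proof (intro conjI ballI impI)
    show "D n \<subseteq> space (config_space S)"
      by (auto simp: D_def sp space_config_space)
    fix x y assume x: "x \<in> D n" and y: "y \<in> space (config_space S)" and le: "\<forall>i\<in>F n. x i \<le> y i"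
    from x obtain z where z: "z \<in> K" "\<forall>k<n. z k \<le> \<phi> x k" by (auto simp: D_def)
    have "\<phi> x k \<le> \<phi> y k" if "k < n" for k
      using le that S from_in[of k] by (auto simp: \<phi>_def F_def)
    then have "\<forall>k<n. z k \<le> \<phi> y k"
      using z(2) by (meson order_trans)
    then show "y \<in> D n"
      using z(1) y by (auto simp: D_def sp space_config_space)
  qed
  have finF: "finite (F n)" for n
  proof (rule finite_imageD)
    show "finite (?idx ` F n)"
      by (rule finite_subset[of _ "{..<n}"]) (auto simp: F_def)
    show "inj_on ?idx (F n)"
      by (rule inj_on_subset[OF inj_on_to_nat_on[OF S]]) (auto simp: F_def)
  qed
  have limit: "(\<Inter>n. D n) \<subseteq> A"
  proof
    fix x assume x: "x \<in> (\<Inter>n. D n)"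
    then have x_sp: "x \<in> space \<mu>" by (auto simp: D_def)
    \<comment> \<open>Membership in each \<open>D n\<close> gives a witness in \<open>K\<close>
      depending on \<open>n\<close>. The closed sets \<open>?L n\<close> decrease, so compactness of
      \<open>K\<close> gives one witness for all coordinates.\<close>
    let ?L = "\<lambda>n. {z. \<forall>k<n. z k \<le> \<phi> x k}"
    have "K \<inter> \<Inter> (?L ` UNIV) \<noteq> {}"
    proof (rule compact_imp_fip_image[OF K(2)])
      show "closed (?L n)" for n
        by (intro closed_Collect_all closed_Collect_imp closed_Collect_le) auto
      fix I' :: "nat set" assume "finite I'"
      then obtain m where m: "\<And>n. n \<in> I' \<Longrightarrow> n \<le> m"
        by (auto simp: finite_nat_set_iff_bounded_le)
      from x obtain z where "z \<in> K" "\<forall>k<m. z k \<le> \<phi> x k" by (auto simp: D_def)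
      then show "K \<inter> \<Inter> (?L ` I') \<noteq> {}"
        using m by (fastforce intro: less_le_trans)
    qed
    then obtain z where z: "z \<in> K" "\<And>k. z k \<le> \<phi> x k" by blast
    have "\<psi> z \<in> A" using z(1) K(1) by (auto simp: A'_def)
    \<comment> \<open>A coordinate of \<open>\<psi> z\<close> is 1 only where \<open>z\<close> is
      positive, and there the natural number \<open>x i\<close> is positive too.\<close>
    moreover have "\<psi> z i \<le> x i" if "i \<in> S" for i
      using z(2)[of "?idx i"] that by (auto simp: \<psi>_def \<phi>_idx)
    ultimately show "x \<in> A"
      using A x_sp by (auto simp: increasing_event_def sp space_config_space)
  qed
  show thesis
  proof (rule that[of F D])
    show "decseq D"
    proof (rule antimonoI)
      fix m n :: nat assume "m \<le> n"
      then show "D n \<subseteq> D m"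
        unfolding D_def by (auto intro: less_le_trans)
    qed
    show "measure \<mu> A - e \<le> measure \<mu> (D n)" for n
    proof -
      have "measure \<mu>' K = measure \<mu> (\<phi> -` K \<inter> space \<mu>)"
        unfolding \<mu>'_def by (rule measure_distr[OF \<phi>_meas]) (simp add: K borel_compact)
      also have "\<dots> \<le> measure \<mu> (D n)"
        using sub increasing_on_sets[OF inc finF] by (intro finite_measure_mono) (auto simp: sets F_def)
      finally show ?thesis using K(3) by simp
    qed
  qed (use finF inc limit in \<open>auto simp: F_def\<close>)
qed

text \<open>Both events are approximated from inside. At each stage the hypothesis applies on the
  union of the two finite coordinate sets, and the limit of the intersections lies inside
  \<open>A \<inter> B\<close>.\<close>

lemma positively_associatedI_finite:
  assumes S: "countable S" and fin: "finite_measure \<mu>" and sets: "sets \<mu> = sets (config_space S)"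
    and ineq: "\<And>F A B. finite F \<Longrightarrow> F \<subseteq> S \<Longrightarrow> increasing_on S F A \<Longrightarrow> increasing_on S F B \<Longrightarrow>
      measure \<mu> A * measure \<mu> B \<le> measure \<mu> (A \<inter> B)"
  shows "positively_associated S \<mu>"
  unfolding positively_associated_def
proof (intro allI impI)
  interpret finite_measure \<mu> by fact
  fix A B assume A: "increasing_event S A" and B: "increasing_event S B"
  show "measure \<mu> A * measure \<mu> B \<le> measure \<mu> (A \<inter> B)"
  proof (rule field_le_epsilon)
    fix e :: real assume "0 < e"
    define M where "M = measure \<mu> (space \<mu>)"
    \<comment> \<open>Replacing both factors by their approximations costs at most
      \<open>2 * M * d\<close>; the added 1 keeps the denominator positive.\<close>
    define d where "d = e / (2 * M + 1)"
    have M: "M \<ge> 0" "measure \<mu> A \<le> M" "measure \<mu> B \<le> M"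
      by (auto simp: M_def bounded_measure)
    have d: "d > 0" "2 * M * d \<le> e"
      using \<open>0 < e\<close> M(1) by (auto simp: d_def field_simps)
    obtain F D where D: "\<And>n. finite (F n)" "\<And>n. F n \<subseteq> S" "\<And>n. increasing_on S (F n) (D n)"
        "decseq D" "(\<Inter>n. D n) \<subseteq> A" "\<And>n. measure \<mu> A - d \<le> measure \<mu> (D n)"
      using increasing_event_inner_approx[OF S fin sets A d(1)] by blast
    obtain G E where E: "\<And>n. finite (G n)" "\<And>n. G n \<subseteq> S" "\<And>n. increasing_on S (G n) (E n)"
        "decseq E" "(\<Inter>n. E n) \<subseteq> B" "\<And>n. measure \<mu> B - d \<le> measure \<mu> (E n)"
      using increasing_event_inner_approx[OF S fin sets B d(1)] by blast
    have Dm: "D n \<in> sets \<mu>" "E n \<in> sets \<mu>" for n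
      using increasing_on_sets[OF D(3,1,2)] increasing_on_sets[OF E(3,1,2)] sets by auto
    have le: "measure \<mu> A * measure \<mu> B - e \<le> measure \<mu> (D n \<inter> E n)" for n
    proof -
      have DM: "measure \<mu> (D n) \<le> M" by (simp add: M_def bounded_measure)
      have "measure \<mu> A * measure \<mu> B \<le> (measure \<mu> (D n) + d) * measure \<mu> B"
        using D(6)[of n] by (intro mult_right_mono) auto
      also have "\<dots> \<le> measure \<mu> (D n) * (measure \<mu> (E n) + d) + d * M"
        using E(6)[of n] M d by (auto simp: distrib_right intro!: add_mono mult_left_mono)
      also have "\<dots> \<le> measure \<mu> (D n) * measure \<mu> (E n) + e"
      proof -
        have "measure \<mu> (D n) * d \<le> M * d"
          using DM d by (intro mult_right_mono) auto
        moreover have "measure \<mu> (D n) * (measure \<mu> (E n) + d) =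
            measure \<mu> (D n) * measure \<mu> (E n) + measure \<mu> (D n) * d" "2 * M * d = M * d + d * M"
          by (simp_all add: algebra_simps)
        ultimately show ?thesis using d(2) by linarith
      qed
      also have "measure \<mu> (D n) * measure \<mu> (E n) \<le> measure \<mu> (D n \<inter> E n)"
        using D(1,2,3)[of n] E(1,2,3)[of n]
        by (intro ineq[of "F n \<union> G n"]) (auto intro: increasing_on_mono)
      finally show ?thesis by simp
    qed
    have "decseq (\<lambda>n. D n \<inter> E n)"
      by (intro antimonoI Int_mono antimonoD[OF D(4)] antimonoD[OF E(4)])
    then have "(\<lambda>n. measure \<mu> (D n \<inter> E n)) \<longlonglongrightarrow> measure \<mu> (\<Inter>n. D n \<inter> E n)"
      using Dm by (intro finite_Lim_measure_decseq) auto
    then have "measure \<mu> A * measure \<mu> B - e \<le> measure \<mu> (\<Inter>n. D n \<inter> E n)"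
      by (rule LIMSEQ_le_const) (use le in auto)
    also have "\<dots> \<le> measure \<mu> (A \<inter> B)"
      using D(5) E(5) A B by (intro finite_measure_mono) (auto simp: increasing_event_def sets)
    finally show "measure \<mu> A * measure \<mu> B \<le> measure \<mu> (A \<inter> B) + e" by simp
  qed
qed

section \<open>Conditioning the Poisson cover\<close>

lemma predI: "{x \<in> space M. P x} \<in> sets M \<Longrightarrow> Measurable.pred M P"
  by (simp add: pred_def)

lemma space_nonempty_subsets: "space (nonempty_subsets S) = Pow S - {{}}"
  by (simp add: nonempty_subsets_def)

lemma sets_nonempty_subsets_mem:
  assumes "i \<in> S"
  shows "{C \<in> Pow S - {{}}. i \<in> C} \<in> sets (nonempty_subsets S)"
proof -
  have "{C \<in> Pow S - {{}}. i \<in> C} =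
      (\<lambda>C. restrict (indicator C) S) -` {x \<in> space (config_space S). x i = 1} \<inter> (Pow S - {{}})"
    using assms by (auto simp: space_config_space indicator_def split: if_splits)
  also have "\<dots> \<in> sets (nonempty_subsets S)"
    unfolding nonempty_subsets_def by (rule in_vimage_algebra[OF sets_coordinate[OF assms]])
  finally show ?thesis .
qed

lemma num_points_eq_0_iff: "num_points J B A w = 0 \<longleftrightarrow> (\<forall>j\<in>J w. B j w \<notin> A)"
  by (auto simp: num_points_def emeasure_count_space_eq_0)

section \<open>Measurability and independence of the counts\<close>

locale random_cover = prob_space M for M :: "'w measure" +
  fixes S :: "'a set" and \<nu> :: "'a set measure"
    and J :: "'w \<Rightarrow> 'j set" and B :: "'j \<Rightarrow> 'w \<Rightarrow> 'a set"
  assumes countable_S: "countable S"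
    and sets_intensity: "sets \<nu> = sets (nonempty_subsets S)"
    and process: "poisson_process M \<nu> J B"
begin

abbreviation count :: "'a set set \<Rightarrow> 'w \<Rightarrow> ennreal" where
  "count \<equiv> num_points J B"

lemma space_intensity: "space \<nu> = Pow S - {{}}"
  using sets_eq_imp_space_eq[OF sets_intensity] by (simp add: space_nonempty_subsets)

lemma points_in: "w \<in> space M \<Longrightarrow> j \<in> J w \<Longrightarrow> B j w \<subseteq> S \<and> B j w \<noteq> {}"
  using process by (auto simp: poisson_process_def space_intensity)

lemma pred_mem: "i \<in> S \<Longrightarrow> Measurable.pred \<nu> (\<lambda>C. i \<in> C)"
  using sets_nonempty_subsets_mem[of i S]
  by (simp add: pred_def sets_intensity space_intensity)

lemma sets_count:
  assumes "V \<in> sets borel" "A \<in> sets \<nu>"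
  shows "{w \<in> space M. count A w \<in> V} \<in> sets M"
proof -
  have "count A \<in> borel_measurable M"
    using process assms by (auto simp: poisson_process_def)
  then show ?thesis using assms by measurable
qed

text \<open>Moves the independence of counts from index sets \<open>{..<n}\<close> to an arbitrary
  finite index set by an enumeration; later the indices are subsets of a finite
  \<open>F\<close>.\<close>

lemma prob_count_indep:
  assumes L: "finite L" and dis: "disjoint_family_on D L" and D: "\<And>c. c \<in> L \<Longrightarrow> D c \<in> sets \<nu>"
    and V: "\<And>c. c \<in> L \<Longrightarrow> V c \<in> sets borel"
  shows "prob {w \<in> space M. \<forall>c\<in>L. count (D c) w \<in> V c} =
    (\<Prod>c\<in>L. prob {w \<in> space M. count (D c) w \<in> V c})"
proof (cases "L = {}")
  case True
  then show ?thesis by (simp add: prob_space)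
next
  case False
  obtain h where h: "bij_betw h {..<card L} L"
    using ex_bij_betw_nat_finite[OF L] by (auto simp: atLeast0LessThan)
  have hL: "h k \<in> L" if "k < card L" for k
    using h that by (auto simp: bij_betw_def)
  have "disjoint_family_on (\<lambda>k. D (h k)) {..<card L}"
    unfolding disjoint_family_on_def
  proof (intro ballI impI)
    fix k l assume "k \<in> {..<card L}" "l \<in> {..<card L}" "k \<noteq> l"
    then have "h k \<in> L" "h l \<in> L" "h k \<noteq> h l"
      using h hL by (auto simp: bij_betw_def inj_on_eq_iff)
    then show "D (h k) \<inter> D (h l) = {}"
      using dis by (auto simp: disjoint_family_on_def)
  qed
  then have ind: "indep_vars (\<lambda>_. borel) (\<lambda>k. count (D (h k))) {..<card L}"
    using process D hL by (auto simp: poisson_process_def)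
  have ne: "{..<card L} \<noteq> {}"
    using False L by (simp add: lessThan_empty_iff)
  have all: "(\<forall>c\<in>L. P c) \<longleftrightarrow> (\<forall>k<card L. P (h k))" for P
  proof safe
    fix c assume "\<forall>k<card L. P (h k)" "c \<in> L"
    moreover have "c \<in> h ` {..<card L}"
      using \<open>c \<in> L\<close> bij_betw_imp_surj_on[OF h] by simp
    ultimately show "P c" by auto
  qed (use hL in auto)
  have "{w \<in> space M. \<forall>c\<in>L. count (D c) w \<in> V c} =
      (\<Inter>k\<in>{..<card L}. count (D (h k)) -` V (h k) \<inter> space M)"
    using ne unfolding all by auto
  also have "prob \<dots> = (\<Prod>k\<in>{..<card L}. prob (count (D (h k)) -` V (h k) \<inter> space M))"
    using ne V hL by (intro indep_varsD_finite[OF ind]) auto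
  also have "\<dots> = (\<Prod>c\<in>L. prob (count (D c) -` V c \<inter> space M))"
    by (rule prod.reindex_bij_betw[OF h])
  finally show ?thesis
    by (simp add: vimage_def Int_def conj_commute)
qed

lemma covered_eq_1_iff: "covered J B i w = 1 \<longleftrightarrow> (\<exists>j\<in>J w. i \<in> B j w)"
  and covered_eq_0_iff: "covered J B i w = 0 \<longleftrightarrow> (\<forall>j\<in>J w. i \<notin> B j w)"
  by (auto simp: covered_def)

lemma covered_le_1: "covered J B i w = 0 \<or> covered J B i w = 1"
  by (auto simp: covered_def)

text \<open>Coordinate \<open>i\<close> equals 1 exactly when the number of points containing
  \<open>i\<close> is nonzero, and this count is a random variable.\<close>

lemma measurable_cover:
  assumes "T \<subseteq> S"
  shows "(\<lambda>w. \<lambda>i\<in>T. covered J B i w) \<in> measurable M (config_space T)"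
proof (rule measurable_config_spaceI)
  show "(\<lambda>i\<in>T. covered J B i w) \<in> T \<rightarrow>\<^sub>E {0, 1}" for w
    using covered_le_1 by auto
  fix i assume i: "i \<in> T"
  have "{w \<in> space M. (\<lambda>i\<in>T. covered J B i w) i = 1} =
      {w \<in> space M. count {C \<in> space \<nu>. i \<in> C} w \<in> - {0}}"
    using i points_in by (auto simp: num_points_eq_0_iff covered_eq_1_iff space_intensity simp del: One_nat_def)
  also have "\<dots> \<in> sets M"
    using i assms by (intro sets_count) (auto intro!: pred_mem predE)
  finally show "{w \<in> space M. (\<lambda>i\<in>T. covered J B i w) i = 1} \<in> sets M" .
qed

lemma prob_space_covered_law: "prob_space (covered_law S M J B)"
  unfolding covered_law_def by (rule prob_space_distr[OF measurable_cover]) simp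

lemma sets_covered_law: "sets (covered_law S M J B) = sets (config_space S)"
  by (simp add: covered_law_def)

lemma agree_event_sets:
  assumes "I \<subseteq> S"
  shows "agree_event S I a \<in> sets (config_space S)"
  unfolding agree_event_def using countable_subset[OF assms countable_S] assms
  by (intro sets.sets_Collect_countable_All' sets_coordinate) auto

lemma measurable_restrict_config:
  "T \<subseteq> S \<Longrightarrow> (\<lambda>x. restrict x T) \<in> measurable (config_space S) (config_space T)"
  unfolding config_space_def by (rule measurable_restrict_subset)

definition agreement :: "'a set \<Rightarrow> ('a \<Rightarrow> nat) \<Rightarrow> 'w set" where
  "agreement I a = {w \<in> space M. \<forall>i\<in>I. covered J B i w = a i}"

lemma measure_covered_law_agree:
  assumes I: "I \<subseteq> S"
  shows "measure (covered_law S M J B) (agree_event S I a) = prob (agreement I a)"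
proof -
  have "measure (covered_law S M J B) (agree_event S I a) =
      prob ((\<lambda>w. \<lambda>i\<in>S. covered J B i w) -` agree_event S I a \<inter> space M)"
    unfolding covered_law_def by (rule measure_distr[OF measurable_cover agree_event_sets[OF I]]) simp
  also have "(\<lambda>w. \<lambda>i\<in>S. covered J B i w) -` agree_event S I a \<inter> space M = agreement I a"
    using I covered_le_1 by (auto simp: agree_event_def agreement_def space_config_space subset_iff)
  finally show ?thesis .
qed

section \<open>Conditional laws of the cover\<close>

context
  fixes I a
  assumes I: "I \<subseteq> S" and pos: "measure (covered_law S M J B) (agree_event S I a) > 0"
begin

lemma emeasure_agree:
  "emeasure (covered_law S M J B) (agree_event S I a) \<noteq> 0"
  "emeasure (covered_law S M J B) (agree_event S I a) \<noteq> \<infinity>"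
proof -
  interpret law: prob_space "covered_law S M J B" by (rule prob_space_covered_law)
  show "emeasure (covered_law S M J B) (agree_event S I a) \<noteq> 0"
    "emeasure (covered_law S M J B) (agree_event S I a) \<noteq> \<infinity>"
    using pos by (auto simp: law.emeasure_eq_measure)
qed

lemma measurable_restrict_uniform:
  "(\<lambda>x. restrict x (S - I)) \<in> measurable
     (uniform_measure (covered_law S M J B) (agree_event S I a)) (config_space (S - I))"
  using measurable_restrict_config[of "S - I"]
  by (simp add: measurable_def sets_covered_law sets_eq_imp_space_eq[OF sets_covered_law])

lemma prob_space_cond_law: "prob_space (cond_law S (covered_law S M J B) I a)"
  unfolding cond_law_def
  using emeasure_agree
  by (intro prob_space.prob_space_distr prob_space_uniform_measure measurable_restrict_uniform)

text \<open>Pulls the conditional law back to \<open>M\<close>, so that later computations concern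
  events of the process itself.\<close>

lemma measure_cond_law:
  assumes A: "A \<in> sets (config_space (S - I))"
  shows "measure (cond_law S (covered_law S M J B) I a) A =
    prob {w \<in> agreement I a. (\<lambda>i\<in>S - I. covered J B i w) \<in> A} / prob (agreement I a)"
proof -
  let ?\<mu> = "covered_law S M J B" and ?E = "agree_event S I a"
  let ?A = "(\<lambda>x. restrict x (S - I)) -` A \<inter> space (config_space S)"
  have A': "?A \<in> sets (config_space S)"
    by (rule measurable_sets[OF measurable_restrict_config A]) simp
  have sp: "space ?\<mu> = space (config_space S)"
    by (rule sets_eq_imp_space_eq[OF sets_covered_law])
  have "measure (cond_law S ?\<mu> I a) A = measure (uniform_measure ?\<mu> ?E) ?A"
    unfolding cond_law_def using measure_distr[OF measurable_restrict_uniform A] by (simp add: sp)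
  also have "\<dots> = measure ?\<mu> (?E \<inter> ?A) / measure ?\<mu> ?E"
    using emeasure_agree A' by (intro measure_uniform_measure) (auto simp: sets_covered_law)
  also have "measure ?\<mu> (?E \<inter> ?A) = prob ((\<lambda>w. \<lambda>i\<in>S. covered J B i w) -` (?E \<inter> ?A) \<inter> space M)"
    unfolding covered_law_def using A' agree_event_sets[OF I]
    by (intro measure_distr[OF measurable_cover]) auto
  also have "(\<lambda>w. \<lambda>i\<in>S. covered J B i w) -` (?E \<inter> ?A) \<inter> space M =
      {w \<in> agreement I a. (\<lambda>i\<in>S - I. covered J B i w) \<in> A}"
  proof -
    have "restrict (\<lambda>i\<in>S. covered J B i w) (S - I) = (\<lambda>i\<in>S - I. covered J B i w)" for w
      by (auto simp: restrict_def)
    then show ?thesis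
      using I covered_le_1 by (auto simp: agree_event_def agreement_def space_config_space subset_iff)
  qed
  finally show ?thesis by (simp add: measure_covered_law_agree[OF I])
qed

end

abbreviation uncovered :: "'a set \<Rightarrow> 'w set" where
  "uncovered I \<equiv> agreement I (\<lambda>_. 0)"

text \<open>The conditioning event says that one count vanishes, namely that of the sets meeting
  \<open>I\<close>. It can therefore join a family of independent count events.\<close>

lemma uncovered_eq:
  assumes "I \<subseteq> S"
  shows "uncovered I = {w \<in> space M. count {C \<in> space \<nu>. \<exists>i\<in>I. i \<in> C} w \<in> {0}}"
  using points_in
  by (auto simp: agreement_def num_points_eq_0_iff covered_eq_0_iff space_intensity)

lemma sets_hit: "I \<subseteq> S \<Longrightarrow> {C \<in> space \<nu>. \<exists>i\<in>I. i \<in> C} \<in> sets \<nu>"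
  using countable_subset[OF _ countable_S, of I]
  by (intro sets.sets_Collect_countable_Ex') (auto intro: predE pred_mem)

lemma sets_uncovered: "I \<subseteq> S \<Longrightarrow> uncovered I \<in> events"
  unfolding uncovered_eq by (intro sets_count sets_hit) auto

section \<open>Traces on a finite set, given that \<open>I\<close> is uncovered\<close>

context
  fixes I
  assumes I: "I \<subseteq> S" and pos: "measure (covered_law S M J B) (agree_event S I (\<lambda>_. 0)) > 0"
begin

text \<open>For distinct \<open>C \<subseteq> F\<close> these sets are disjoint from each other and
  from the sets meeting \<open>I\<close>, so their counts are independent of the conditioning
  event.\<close>

definition hits :: "'a set \<Rightarrow> 'a set \<Rightarrow> 'a set set" where
  "hits F C = {X \<in> space \<nu>. (\<forall>i\<in>I. i \<notin> X) \<and> (\<forall>i\<in>F. i \<in> X \<longleftrightarrow> i \<in> C)}"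

lemma sets_hits:
  assumes "finite F" "F \<subseteq> S"
  shows "hits F C \<in> sets \<nu>"
proof -
  have cI: "countable I" using I countable_S countable_subset by blast
  have "{X \<in> space \<nu>. \<forall>i\<in>I. i \<notin> X} \<in> sets \<nu>"
    using I cI by (intro sets.sets_Collect_countable_All' sets.sets_Collect_neg predE pred_mem) auto
  moreover have "{X \<in> space \<nu>. \<forall>i\<in>F. i \<in> X \<longleftrightarrow> i \<in> C} \<in> sets \<nu>"
    using assms by (intro sets.sets_Collect_finite_All predE pred_intros_logic pred_mem) auto
  ultimately have "{X \<in> space \<nu>. \<forall>i\<in>I. i \<notin> X} \<inter> {X \<in> space \<nu>. \<forall>i\<in>F. i \<in> X \<longleftrightarrow> i \<in> C} \<in> sets \<nu>"
    by auto
  also have "{X \<in> space \<nu>. \<forall>i\<in>I. i \<notin> X} \<inter> {X \<in> space \<nu>. \<forall>i\<in>F. i \<in> X \<longleftrightarrow> i \<in> C} = hits F C"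
    by (auto simp: hits_def)
  finally show ?thesis .
qed

text \<open>The empty trace covers nothing in \<open>F\<close>. Leaving it out also frees the index
  \<open>{}\<close> for the conditioning event in \<open>prob_traces\<close>.\<close>

definition traces :: "'a set \<Rightarrow> 'w \<Rightarrow> 'a set set" where
  "traces F w = {C \<in> Pow F - {{}}. count (hits F C) w \<noteq> 0}"

definition hit_prob :: "'a set \<Rightarrow> 'a set \<Rightarrow> real" where
  "hit_prob F C = prob {w \<in> space M. count (hits F C) w \<noteq> 0}"

lemma sets_hits_count: "finite F \<Longrightarrow> F \<subseteq> S \<Longrightarrow> {w \<in> space M. count (hits F C) w \<noteq> 0} \<in> events"
  using sets_count[of "- {0}" "hits F C"] sets_hits[of F C] by simp

lemma traces_sets:
  assumes "finite F" "F \<subseteq> S"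
  shows "{w \<in> uncovered I. traces F w = V} \<in> events"
proof -
  have "{w \<in> space M. (\<forall>C\<in>Pow F - {{}}. (count (hits F C) w \<noteq> 0) = (C \<in> V))} \<in> events"
    using assms
    by (intro sets.sets_Collect_finite_All predE pred_intros_logic sets_hits_count[THEN predI]) auto
  \<comment> \<open>The last factor makes the event empty for families \<open>V\<close> that are not
    possible values of \<open>traces F\<close>.\<close>
  then have "uncovered I \<inter> {w \<in> space M. (\<forall>C\<in>Pow F - {{}}. (count (hits F C) w \<noteq> 0) = (C \<in> V))} \<inter>
     (if V \<subseteq> Pow F - {{}} then space M else {}) \<in> events"
    using sets_uncovered[OF I] by auto
  also have "uncovered I \<inter> {w \<in> space M. (\<forall>C\<in>Pow F - {{}}. (count (hits F C) w \<noteq> 0) = (C \<in> V))} \<inter>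
     (if V \<subseteq> Pow F - {{}} then space M else {}) = {w \<in> uncovered I. traces F w = V}"
    by (auto simp: traces_def agreement_def)
  finally show ?thesis .
qed

text \<open>Independence of counts over disjoint sets: given \<open>uncovered I\<close>, the random
  family \<open>traces F\<close> contains each nonempty \<open>C \<subseteq> F\<close> independently
  with probability \<open>hit_prob F C\<close>.\<close>

lemma prob_traces:
  assumes F: "finite F" "F \<subseteq> S" and V: "V \<subseteq> Pow F - {{}}"
  shows "prob {w \<in> uncovered I. traces F w = V} = prob (uncovered I) *
    ((\<Prod>C\<in>V. hit_prob F C) * (\<Prod>C\<in>(Pow F - {{}}) - V. 1 - hit_prob F C))"
proof -
  let ?K = "Pow F - {{}}"
  \<comment> \<open>The index \<open>{}\<close> carries the sets meeting \<open>I\<close>. Since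
    \<open>{}\<close> is not in \<open>V\<close>, its prescribed value in \<open>Val\<close> is 0,
    which is the event \<open>uncovered I\<close>.\<close>
  define D where "D C = (if C = {} then {X \<in> space \<nu>. \<exists>i\<in>I. i \<in> X} else hits F C)" for C
  define Val :: "'a set \<Rightarrow> ennreal set" where "Val C = (if C \<in> V then - {0} else {0})" for C
  have V0: "{} \<notin> V" using V by auto
  have D_sets: "D C \<in> sets \<nu>" for C
    unfolding D_def using F sets_hits sets_hit[OF I] by auto
  have dis: "disjoint_family_on D (Pow F)"
    unfolding disjoint_family_on_def by (auto simp: D_def hits_def)
  have "{w \<in> uncovered I. traces F w = V} = {w \<in> space M. \<forall>C\<in>Pow F. count (D C) w \<in> Val C}"
  proof -
    have "Pow F = insert {} ?K" by auto
    then have "{w \<in> space M. \<forall>C\<in>Pow F. count (D C) w \<in> Val C} =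
        uncovered I \<inter> {w \<in> space M. \<forall>C\<in>?K. count (hits F C) w \<in> Val C}"
      using V0 by (auto simp: uncovered_eq[OF I] D_def Val_def)
    also have "\<dots> = {w \<in> uncovered I. traces F w = V}"
      using V by (auto simp: Val_def traces_def agreement_def split: if_splits)
    finally show ?thesis ..
  qed
  also have "prob \<dots> = (\<Prod>C\<in>Pow F. prob {w \<in> space M. count (D C) w \<in> Val C})"
    using F dis D_sets by (intro prob_count_indep) (auto simp: Val_def)
  also have "Pow F = insert {} ?K" by auto
  also have "(\<Prod>C\<in>insert {} ?K. prob {w \<in> space M. count (D C) w \<in> Val C}) =
      prob {w \<in> space M. count (D {}) w \<in> Val {}} * (\<Prod>C\<in>?K. prob {w \<in> space M. count (D C) w \<in> Val C})"
    using F by (subst prod.insert) auto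
  also have "prob {w \<in> space M. count (D {}) w \<in> Val {}} = prob (uncovered I)"
    using V0 by (simp add: uncovered_eq[OF I] D_def Val_def)
  also have "(\<Prod>C\<in>?K. prob {w \<in> space M. count (D C) w \<in> Val C}) =
      (\<Prod>C\<in>?K. if C \<in> V then hit_prob F C else 1 - hit_prob F C)"
  proof (rule prod.cong)
    fix C assume "C \<in> ?K"
    moreover have "prob {w \<in> space M. count (hits F C) w = 0} = 1 - hit_prob F C"
      using prob_neg[OF sets_hits_count[OF F]] by (simp add: hit_prob_def)
    ultimately show "prob {w \<in> space M. count (D C) w \<in> Val C} =
        (if C \<in> V then hit_prob F C else 1 - hit_prob F C)"
      by (auto simp: D_def Val_def hit_prob_def)
  qed simp
  also have "\<dots> = (\<Prod>C\<in>?K - V. if C \<in> V then hit_prob F C else 1 - hit_prob F C) *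
      (\<Prod>C\<in>V. if C \<in> V then hit_prob F C else 1 - hit_prob F C)"
    using F V by (intro prod.subset_diff) auto
  finally show ?thesis by (simp add: mult.commute)
qed

text \<open>For \<open>V = traces F w\<close> this vanishes off \<open>F\<close>, so it reproduces
  the cover only on \<open>F\<close>; events determined by \<open>F\<close> do not see the
  difference.\<close>

definition config_of :: "'a set set \<Rightarrow> 'a \<Rightarrow> nat" where
  "config_of V = (\<lambda>i\<in>S - I. if i \<in> \<Union>V then 1 else 0)"

lemma config_of_space: "config_of V \<in> space (config_space (S - I))"
  by (auto simp: config_of_def space_config_space)

text \<open>On \<open>uncovered I\<close> every point misses \<open>I\<close>, so a point containing
  \<open>i\<close> contributes its trace on \<open>F\<close> to \<open>traces F w\<close>;
  conversely each recorded trace comes from a point.\<close>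

lemma config_of_traces:
  assumes F: "F \<subseteq> S - I" and w: "w \<in> uncovered I" and i: "i \<in> F"
  shows "(\<lambda>i\<in>S - I. covered J B i w) i = config_of (traces F w) i"
proof -
  have wM: "w \<in> space M" using w by (simp add: agreement_def)
  have "(\<exists>j\<in>J w. i \<in> B j w) \<longleftrightarrow> i \<in> \<Union> (traces F w)"
  proof
    assume "\<exists>j\<in>J w. i \<in> B j w"
    then obtain j where j: "j \<in> J w" "i \<in> B j w" by auto
    have "B j w \<in> hits F (B j w \<inter> F)"
      using points_in[OF wM j(1)] w j(1)
      by (auto simp: hits_def space_intensity agreement_def covered_eq_0_iff)
    then have "B j w \<inter> F \<in> traces F w"
      using j i by (auto simp: traces_def num_points_eq_0_iff)
    then show "i \<in> \<Union> (traces F w)"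
      using j i by auto
  next
    assume "i \<in> \<Union> (traces F w)"
    then show "\<exists>j\<in>J w. i \<in> B j w"
      using i by (auto simp: traces_def num_points_eq_0_iff hits_def)
  qed
  then show ?thesis
    using F i by (auto simp: config_of_def covered_def)
qed

text \<open>The event is split by the value of \<open>traces F\<close>. By
  \<open>prob_traces\<close> each piece carries the factor \<open>prob (uncovered I)\<close>, which
  cancels against the normalisation.\<close>

lemma measure_cond_law_increasing_on:
  assumes F: "finite F" "F \<subseteq> S - I" and A: "increasing_on (S - I) F A"
  shows "measure (cond_law S (covered_law S M J B) I (\<lambda>_. 0)) A =
    bernoulli_mean (hit_prob F) (Pow F - {{}}) (\<lambda>V. indicator A (config_of V))"
proof -
  let ?K = "Pow F - {{}}"
  have FS: "F \<subseteq> S" using F by auto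
  have space: "(\<lambda>i\<in>S - I. covered J B i w) \<in> space (config_space (S - I))" for w
    using covered_le_1 by (auto simp: space_config_space)
  \<comment> \<open>The two configurations coincide on \<open>F\<close>, so
    \<open>increasing_on\<close> transfers membership both ways.\<close>
  have agree: "(\<lambda>i\<in>S - I. covered J B i w) \<in> A \<longleftrightarrow> config_of (traces F w) \<in> A"
    if "w \<in> uncovered I" for w
    using A space[of w] config_of_space config_of_traces[OF F(2) that]
    unfolding increasing_on_def by (metis order_refl)
  let ?V = "{V \<in> Pow ?K. config_of V \<in> A}"
  have finV: "finite ?V" using F by auto
  have "{w \<in> uncovered I. (\<lambda>i\<in>S - I. covered J B i w) \<in> A} =
      (\<Union>V\<in>?V. {w \<in> uncovered I. traces F w = V})"
    using agree by (auto simp: traces_def)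
  then have "prob {w \<in> uncovered I. (\<lambda>i\<in>S - I. covered J B i w) \<in> A} =
      (\<Sum>V\<in>?V. prob {w \<in> uncovered I. traces F w = V})"
    using finV traces_sets[OF F(1) FS]
    by (simp only:) (intro finite_measure_finite_Union, auto simp: disjoint_family_on_def)
  also have "\<dots> = (\<Sum>V\<in>?V. prob (uncovered I) *
      ((\<Prod>C\<in>V. hit_prob F C) * (\<Prod>C\<in>?K - V. 1 - hit_prob F C)))"
    by (intro sum.cong refl prob_traces[OF F(1) FS]) auto
  also have "\<dots> = prob (uncovered I) *
      bernoulli_mean (hit_prob F) ?K (\<lambda>V. indicator A (config_of V))"
    unfolding bernoulli_mean_def sum_distrib_left using F
    by (intro sum.mono_neutral_cong_left) (auto simp: indicator_def)
  finally show ?thesis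
    using pos measure_cond_law[OF I pos increasing_on_sets[OF A F]]
    by (simp add: measure_covered_law_agree[OF I])
qed

text \<open>More traces cover more coordinates, so the indicators of increasing events are
  increasing functions of the family of traces, and \<open>harris_inequality\<close>
  applies.\<close>

lemma cond_law_positively_associated:
  "positively_associated (S - I) (cond_law S (covered_law S M J B) I (\<lambda>_. 0))"
proof (rule positively_associatedI_finite)
  let ?\<mu> = "cond_law S (covered_law S M J B) I (\<lambda>_. 0)"
  show "finite_measure ?\<mu>"
    using prob_space_cond_law[OF I pos] by (rule prob_space.finite_measure)
  fix F A A' assume F: "finite F" "F \<subseteq> S - I" and A: "increasing_on (S - I) F A" "increasing_on (S - I) F A'"
  have mono: "indicator X (config_of U) \<le> (indicator X (config_of V) :: real)"
    if X: "increasing_on (S - I) F X" and UV: "U \<subseteq> V" for X U V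
  proof -
    have "config_of U i \<le> config_of V i" if "i \<in> F" for i
      using UV that F by (auto simp: config_of_def)
    then show ?thesis
      using X config_of_space[of V] by (auto simp: increasing_on_def indicator_def)
  qed
  have "measure ?\<mu> A * measure ?\<mu> A' \<le> bernoulli_mean (hit_prob F) (Pow F - {{}})
      (\<lambda>V. indicator A (config_of V) * indicator A' (config_of V))"
    unfolding measure_cond_law_increasing_on[OF F A(1)] measure_cond_law_increasing_on[OF F A(2)]
    using F A mono by (intro harris_inequality) (auto simp: hit_prob_def)
  also have "\<dots> = measure ?\<mu> (A \<inter> A')"
    by (simp add: measure_cond_law_increasing_on[OF F increasing_on_Int[OF A]] indicator_inter_arith)
  finally show "measure ?\<mu> A * measure ?\<mu> A' \<le> measure ?\<mu> (A \<inter> A')" .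
qed (use countable_S in \<open>auto simp: cond_law_def\<close>)

end

lemma downward_FKG_covered_law: "downward_FKG S (covered_law S M J B)"
  unfolding downward_FKG_def using cond_law_positively_associated by blast

end

lemma random_cover_if_poisson:
  assumes "countable S" "sets \<nu> = sets (nonempty_subsets S)" "poisson_process M \<nu> J B"
  shows "random_cover M S \<nu> J B"
  using assms by (auto simp: random_cover_def random_cover_axioms_def poisson_process_def)

section \<open>A cover without the FKG property\<close>

text \<open>The sample point records multiplicities: \<open>w 0\<close> and \<open>w 1\<close> are
  the numbers of copies of the two edges.\<close>

definition pair_law :: "(nat \<Rightarrow> nat) pmf" where
  "pair_law = Pi_pmf {0, 1} 0 (\<lambda>_. poisson_pmf 1)"

definition edge :: "nat \<Rightarrow> nat set" where
  "edge k = {0, Suc k}"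

definition edge_intensity :: "nat set measure" where
  "edge_intensity = distr (count_space {0, 1}) (nonempty_subsets {0, 1, 2}) edge"

text \<open>Index \<open>2 * m + k\<close> stands for the \<open>m\<close>-th copy of \<open>edge k\<close>.\<close>

definition edge_index :: "(nat \<Rightarrow> nat) \<Rightarrow> nat set" where
  "edge_index w = {j. j div 2 < w (j mod 2)}"

definition edge_point :: "nat \<Rightarrow> (nat \<Rightarrow> nat) \<Rightarrow> nat set" where
  "edge_point j w = edge (j mod 2)"

definition edges_in :: "nat set set \<Rightarrow> nat set" where
  "edges_in A = {k \<in> {0, 1}. edge k \<in> A}"

lemma finite_edges_in [simp]: "finite (edges_in A)"
  by (simp add: edges_in_def)

lemma edge_meas: "edge \<in> measurable (count_space {0, 1}) (nonempty_subsets {0, 1, 2})"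
  by (auto simp: space_nonempty_subsets edge_def)

lemma sets_edge_intensity: "sets edge_intensity = sets (nonempty_subsets {0, 1, 2})"
  by (simp add: edge_intensity_def)

lemma emeasure_edge_intensity:
  assumes "A \<in> sets edge_intensity"
  shows "emeasure edge_intensity A = ennreal (real (card (edges_in A)))"
proof -
  have "emeasure edge_intensity A = emeasure (count_space {0, 1}) (edge -` A \<inter> {0, 1})"
    using emeasure_distr[OF edge_meas, of A] assms
    by (simp add: edge_intensity_def)
  also have "edge -` A \<inter> {0, 1} = edges_in A"
    by (auto simp: edges_in_def)
  also have "emeasure (count_space {0, 1}) (edges_in A) = ennreal (real (card (edges_in A)))"
    by (subst emeasure_count_space_finite) (auto simp: edges_in_def ennreal_of_nat_eq_real_of_nat)
  finally show ?thesis .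
qed

lemma finite_measure_edge_intensity: "finite_measure edge_intensity"
  using emeasure_edge_intensity[of "space edge_intensity"] by (intro finite_measureI) simp

text \<open>Division with remainder by 2 matches indices with pairs of an edge and a copy number, so
  the count is a sum of multiplicities.\<close>

lemma num_points_edge:
  "num_points edge_index edge_point A w = ennreal (real (\<Sum>k\<in>edges_in A. w k))"
proof -
  let ?f = "\<lambda>(k, m). 2 * m + k :: nat" and ?X = "SIGMA k:edges_in A. {..<w k}"
  have "{j \<in> edge_index w. edge_point j w \<in> A} = ?f ` ?X"
  proof (intro set_eqI iffI)
    fix j assume "j \<in> {j \<in> edge_index w. edge_point j w \<in> A}"
    then show "j \<in> ?f ` ?X"
      by (intro image_eqI[of _ _ "(j mod 2, j div 2)"])
        (auto simp: edge_index_def edge_point_def edges_in_def)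
  next
    fix j assume "j \<in> ?f ` ?X"
    then obtain k m where "j = 2 * m + k" "k \<in> edges_in A" "m < w k"
      by (elim imageE) auto
    then have "j = 2 * m + k" "k < 2" "m < w k" "edge k \<in> A"
      by (auto simp: edges_in_def)
    then show "j \<in> {j \<in> edge_index w. edge_point j w \<in> A}"
      by (simp add: edge_index_def edge_point_def)
  qed
  moreover have "inj_on ?f ?X"
    by (auto simp: inj_on_def edges_in_def) presburger+
  ultimately have "card {j \<in> edge_index w. edge_point j w \<in> A} = (\<Sum>k\<in>edges_in A. w k)"
      "finite {j \<in> edge_index w. edge_point j w \<in> A}"
    by (simp_all add: card_image)
  then show ?thesis
    by (simp add: num_points_def emeasure_count_space_finite ennreal_of_nat_eq_real_of_nat)
qed

lemma prob_pair_law: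
  "measure_pmf.prob pair_law {w. w 0 \<in> U \<and> w 1 \<in> V} =
     measure_pmf.prob (poisson_pmf 1) U * measure_pmf.prob (poisson_pmf 1) V"
proof -
  have "{w. w 0 \<in> U \<and> w 1 \<in> V} = Pi {0, 1} (\<lambda>k::nat. if k = 0 then U else V)"
    by (auto simp: Pi_def)
  then show ?thesis
    unfolding pair_law_def by (simp add: measure_Pi_pmf_Pi)
qed

text \<open>Sums of independent Poisson variables. For both edges, splitting by the value of
  \<open>w 0\<close> leaves the row sum of binomial coefficients; for \<open>K = {}\<close> the
  formula relies on \<open>0 ^ 0 = 1\<close>.\<close>

lemma prob_pair_law_sum:
  assumes "K \<subseteq> {0, 1}"
  shows "measure_pmf.prob pair_law {w. (\<Sum>k\<in>K. w k) = n} =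
    real (card K) ^ n / fact n * exp (- real (card K))"
proof -
  consider "K = {}" | "K = {0}" | "K = {1}" | "K = {0, 1}"
    using assms by blast
  then show ?thesis
  proof cases
    case 1
    then show ?thesis by (cases "n = 0") auto
  next
    case 2
    then show ?thesis
      using prob_pair_law[of "{n}" UNIV] by (simp add: measure_pmf_single)
  next
    case 3
    then show ?thesis
      using prob_pair_law[of UNIV "{n}"] by (simp add: measure_pmf_single)
  next
    case 4
    have "{w. (\<Sum>k\<in>K. w k) = n} = (\<Union>i\<in>{..n}. {w. w 0 \<in> {i} \<and> w 1 \<in> {n - i}})"
      using 4 by auto
    then have "measure_pmf.prob pair_law {w. (\<Sum>k\<in>K. w k) = n} =
        (\<Sum>i\<le>n. measure_pmf.prob pair_law {w. w 0 \<in> {i} \<and> w 1 \<in> {n - i}})"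
      by (simp only:) (intro measure_pmf.finite_measure_finite_Union, auto simp: disjoint_family_on_def)
    also have "\<dots> = (\<Sum>i\<le>n. real (n choose i) * (exp (- 2) / fact n))"
    proof (rule sum.cong)
      fix i assume "i \<in> {..n}"
      moreover have "exp (- 1) * exp (- 1) = (exp (- 2) :: real)"
        by (simp flip: exp_add)
      ultimately show "measure_pmf.prob pair_law {w. w 0 \<in> {i} \<and> w 1 \<in> {n - i}} =
          real (n choose i) * (exp (- 2) / fact n)"
        unfolding prob_pair_law by (simp add: measure_pmf_single binomial_fact)
    qed simp
    also have "\<dots> = (\<Sum>i\<le>n. real (n choose i)) * (exp (- 2) / fact n)"
      by (rule sum_distrib_right[symmetric])
    also have "(\<Sum>i\<le>n. real (n choose i)) = 2 ^ n"
      using choose_row_sum[of n] by (simp flip: of_nat_sum)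
    finally show ?thesis using 4 by simp
  qed
qed

text \<open>Disjoint sets \<open>A j\<close> contain disjoint groups of edges, so their counts are
  functions of disjoint blocks of independent coordinates. The clause for infinite intensity is
  vacuous, as the intensity is finite.\<close>

lemma poisson_process_edges:
  "poisson_process (measure_pmf pair_law) edge_intensity edge_index edge_point"
  unfolding poisson_process_def
proof (intro conjI ballI allI impI)
  let ?N = "num_points edge_index edge_point"
  show "prob_space pair_law" by (rule measure_pmf.prob_space_axioms)
  show "edge_point j w \<in> space edge_intensity" for j w
    by (auto simp: edge_intensity_def space_nonempty_subsets edge_point_def edge_def)
  show "?N A \<in> borel_measurable (measure_pmf pair_law)" for A
    by simp
  fix A assume A: "A \<in> sets edge_intensity"
  have m: "measure edge_intensity A = real (card (edges_in A))"
    using emeasure_edge_intensity[OF A] by (simp add: measure_def)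
  show "measure_pmf.prob pair_law {w \<in> space (measure_pmf pair_law). ?N A w = of_nat n} =
      measure edge_intensity A ^ n / fact n * exp (- measure edge_intensity A)" for n
  proof -
    have "{w \<in> space (measure_pmf pair_law). ?N A w = of_nat n} = {w. (\<Sum>k\<in>edges_in A. w k) = n}"
      by (simp only: num_points_edge of_nat_eq_iff space_measure_pmf UNIV_I simp_thms
          flip: ennreal_of_nat_eq_real_of_nat)
    then show ?thesis
      unfolding m by (simp only:) (rule prob_pair_law_sum, auto simp: edges_in_def)
  qed
  show "AE w in pair_law. ?N A w = \<infinity>" if "emeasure edge_intensity A = \<infinity>"
    using that emeasure_edge_intensity[OF A] by simp
next
  let ?N = "num_points edge_index edge_point"
  fix n :: nat and A :: "nat \<Rightarrow> nat set set"
  assume dis: "disjoint_family_on A {..<n}"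
  let ?K = "\<lambda>j. edges_in (A j)"
  have "disjoint_family_on ?K {..<n}"
    unfolding disjoint_family_on_def
  proof (intro ballI impI)
    fix i j assume "i \<in> {..<n}" "j \<in> {..<n}" "i \<noteq> j"
    then have "A i \<inter> A j = {}" using dis by (auto simp: disjoint_family_on_def)
    then show "?K i \<inter> ?K j = {}" by (auto simp: edges_in_def)
  qed
  then have "prob_space.indep_vars pair_law (\<lambda>j. PiM (?K j) (\<lambda>_. count_space UNIV))
      (\<lambda>j w. restrict (\<lambda>k. w k) (?K j)) {..<n}"
    unfolding pair_law_def
    by (intro prob_space.indep_vars_restrict[OF measure_pmf.prob_space_axioms indep_vars_Pi_pmf])
      (auto simp: edges_in_def)
  then have "prob_space.indep_vars pair_law (\<lambda>_. borel)
      (\<lambda>j w. ennreal (real (\<Sum>k\<in>?K j. restrict (\<lambda>k. w k) (?K j) k))) {..<n}"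
  proof (rule prob_space.indep_vars_compose2[where Y = "\<lambda>j f. ennreal (real (sum f (?K j)))",
        OF measure_pmf.prob_space_axioms])
    fix j assume "j \<in> {..<n}"
    have "(\<lambda>f. ennreal (\<Sum>k\<in>?K j. real (f k))) \<in> borel_measurable (PiM (?K j) (\<lambda>_. count_space UNIV))"
      by (intro measurable_compose[OF _ measurable_ennreal] borel_measurable_sum
          measurable_compose[OF measurable_component_singleton]) auto
    then show "(\<lambda>f. ennreal (real (sum f (?K j)))) \<in> borel_measurable (PiM (?K j) (\<lambda>_. count_space UNIV))"
      by simp
  qed
  then show "prob_space.indep_vars pair_law (\<lambda>_. borel) (\<lambda>j. ?N (A j)) {..<n}"
    by (simp add: num_points_edge[abs_def])
qed

section \<open>Negative correlation given that 0 is covered\<close>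

lemma covered_edges: "covered edge_index edge_point i w = 1 \<longleftrightarrow> (\<exists>k\<in>{0, 1}. 0 < w k \<and> i \<in> edge k)"
proof -
  have "(\<exists>j\<in>edge_index w. i \<in> edge_point j w) \<longleftrightarrow> (\<exists>k\<in>{0, 1}. 0 < w k \<and> i \<in> edge k)"
  proof
    assume "\<exists>j\<in>edge_index w. i \<in> edge_point j w"
    then obtain j where "j \<in> edge_index w" "i \<in> edge_point j w" ..
    then show "\<exists>k\<in>{0, 1}. 0 < w k \<and> i \<in> edge k"
      by (intro bexI[of _ "j mod 2"]) (auto simp: edge_index_def edge_point_def)
  next
    assume "\<exists>k\<in>{0, 1}. 0 < w k \<and> i \<in> edge k"
    then obtain k where "k \<in> {0, 1}" "0 < w k" "i \<in> edge k" by blast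
    \<comment> \<open>For \<open>k < 2\<close> the index \<open>k\<close> itself is copy number 0 of
      \<open>edge k\<close>.\<close>
    then show "\<exists>j\<in>edge_index w. i \<in> edge_point j w"
      by (intro bexI[of _ k]) (auto simp: edge_index_def edge_point_def)
  qed
  then show ?thesis by (auto simp: covered_def)
qed

text \<open>Let \<open>r\<close> be the probability that a given edge is absent. Given that 0 is
  covered, 1 and 2 are each covered with probability \<open>(1 - r) / q\<close> and both with
  probability \<open>(1 - r)\<^sup>2 / q\<close>, where \<open>q = 1 - r\<^sup>2\<close>. The joint
  probability is \<open>q < 1\<close> times the product.\<close>

lemma not_FKG_edges:
  "\<not> FKG {0, 1, 2} (covered_law {0, 1, 2} (measure_pmf pair_law) edge_index edge_point)"
proof
  let ?S = "{0, 1, 2} :: nat set" and ?one = "\<lambda>_. 1 :: nat"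
  let ?\<mu> = "covered_law ?S (measure_pmf pair_law) edge_index edge_point"
  let ?c = "covered edge_index edge_point"
  assume FKG: "FKG ?S ?\<mu>"
  interpret random_cover "measure_pmf pair_law" ?S edge_intensity edge_index edge_point
    using sets_edge_intensity poisson_process_edges by (intro random_cover_if_poisson) auto
  define r :: real where "r = exp (- 1)"
  have r: "0 < r" "r < 1" by (auto simp: r_def)
  have P0: "measure_pmf.prob (poisson_pmf 1) {0} = r"
    by (simp add: measure_pmf_single r_def)
  have Ppos: "measure_pmf.prob (poisson_pmf 1) {0<..} = 1 - r"
  proof -
    have "{0<..} = UNIV - {0 :: nat}" by auto
    then show ?thesis using measure_pmf.prob_compl[of "{0}" "poisson_pmf 1"] P0 by simp
  qed
  have c0: "?c 0 w = 1 \<longleftrightarrow> 0 < w 0 \<or> 0 < w 1" and c1: "?c 1 w = 1 \<longleftrightarrow> 0 < w 0"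
    and c2: "?c 2 w = 1 \<longleftrightarrow> 0 < w 1" for w
    unfolding covered_edges by (auto simp: edge_def)
  \<comment> \<open>Both edges contain 0, so 0 stays uncovered only if both are absent.\<close>
  have E: "agreement {0} ?one = UNIV - {w. w 0 \<in> {0} \<and> w 1 \<in> {0}}"
    using c0 by (auto simp: agreement_def)
  have prob_E: "measure_pmf.prob pair_law (agreement {0} ?one) = 1 - r\<^sup>2"
  proof -
    have "measure_pmf.prob pair_law (agreement {0} ?one) = 1 - measure_pmf.prob pair_law {w. w 0 \<in> {0} \<and> w 1 \<in> {0}}"
      unfolding E using measure_pmf.prob_compl[of "{w. w 0 \<in> {0} \<and> w 1 \<in> {0}}" pair_law]
      by (simp only: space_measure_pmf sets_measure_pmf UNIV_I)
    then show ?thesis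
      by (simp only: prob_pair_law P0 power2_eq_square)
  qed
  have q: "0 < 1 - r\<^sup>2" "1 - r\<^sup>2 < 1"
    using r by (auto simp: power_less_one_iff)
  have pos: "measure ?\<mu> (agree_event ?S {0} ?one) > 0"
    using q measure_covered_law_agree[of "{0}" ?one] prob_E by simp
  have S0: "?S - {0} = {1, 2}" by auto
  define A where "A i = {x \<in> space (config_space (?S - {0})). x i = 1}" for i :: nat
  have A_sets: "A i \<in> sets (config_space (?S - {0}))" if "i \<in> {1, 2}" for i
    unfolding A_def using that by (intro sets_coordinate) auto
  have inc: "increasing_event (?S - {0}) (A i)" if "i \<in> {1, 2}" for i
    unfolding increasing_event_def
  proof (intro conjI ballI impI A_sets that)
    fix x y assume x: "x \<in> A i" and y: "y \<in> space (config_space (?S - {0}))"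
      and "\<forall>i\<in>?S - {0}. x i \<le> y i"
    then have "1 \<le> y i" using that by (auto simp: A_def)
    moreover have "y i \<in> {0, 1}"
      using PiE_mem[of y "?S - {0}" "\<lambda>_. {0, 1}" i] y that by (auto simp: space_config_space)
    ultimately show "y \<in> A i" using y by (auto simp: A_def)
  qed
  have mem: "(\<lambda>i\<in>?S - {0}. ?c i w) \<in> A i \<longleftrightarrow> ?c i w = 1" if "i \<in> {1, 2}" for i w
    using that covered_le_1 by (auto simp: A_def space_config_space)
  note cond = measure_cond_law[OF _ pos, unfolded prob_E]
  have "measure (cond_law ?S ?\<mu> {0} ?one) (A 1) = (1 - r) / (1 - r\<^sup>2)"
  proof -
    have "{w \<in> agreement {0} ?one. (\<lambda>i\<in>?S - {0}. ?c i w) \<in> A 1} = {w. w 0 \<in> {0<..} \<and> w 1 \<in> UNIV}"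
      using mem[of 1] c0 c1 by (auto simp: agreement_def)
    then show ?thesis
      using cond[of "A 1"] A_sets[of 1] by (simp only: prob_pair_law) (simp add: Ppos)
  qed
  moreover have "measure (cond_law ?S ?\<mu> {0} ?one) (A 2) = (1 - r) / (1 - r\<^sup>2)"
  proof -
    have "{w \<in> agreement {0} ?one. (\<lambda>i\<in>?S - {0}. ?c i w) \<in> A 2} = {w. w 0 \<in> UNIV \<and> w 1 \<in> {0<..}}"
      using mem[of 2] c0 c2 by (auto simp: agreement_def)
    then show ?thesis
      using cond[of "A 2"] A_sets[of 2] by (simp only: prob_pair_law) (simp add: Ppos)
  qed
  moreover have "measure (cond_law ?S ?\<mu> {0} ?one) (A 1 \<inter> A 2) = (1 - r)\<^sup>2 / (1 - r\<^sup>2)"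
  proof -
    have "{w \<in> agreement {0} ?one. (\<lambda>i\<in>?S - {0}. ?c i w) \<in> A 1 \<inter> A 2} =
        {w. w 0 \<in> {0<..} \<and> w 1 \<in> {0<..}}"
      using mem[of 1] mem[of 2] c0 c1 c2 by (auto simp: agreement_def)
    then show ?thesis
      using cond[of "A 1 \<inter> A 2"] A_sets[of 1] A_sets[of 2]
      by (simp only: prob_pair_law) (simp add: Ppos power2_eq_square)
  qed
  moreover have "positively_associated (?S - {0}) (cond_law ?S ?\<mu> {0} ?one)"
    using FKG pos unfolding FKG_def by auto
  ultimately have "(1 - r) / (1 - r\<^sup>2) * ((1 - r) / (1 - r\<^sup>2)) \<le> (1 - r)\<^sup>2 / (1 - r\<^sup>2)"
    using inc[of 1] inc[of 2] unfolding positively_associated_def by fastforce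
  \<comment> \<open>The right side is the product of the two conditional probabilities; it is
    strictly larger because \<open>1 / (1 - r\<^sup>2) > 1\<close>.\<close>
  moreover have "(1 - r)\<^sup>2 / (1 - r\<^sup>2) * 1 < (1 - r)\<^sup>2 / (1 - r\<^sup>2) * (1 / (1 - r\<^sup>2))"
    using r q by (intro mult_strict_left_mono divide_pos_pos) auto
  ultimately show False
    by (simp add: power2_eq_square)
qed

theorem theorem2p4:
  shows "(\<forall>(S :: 'a set) (\<nu> :: 'a set measure) (M :: 'w measure)
            (J :: 'w \<Rightarrow> 'j set) (B :: 'j \<Rightarrow> 'w \<Rightarrow> 'a set).
            countable S \<longrightarrow>
            sets \<nu> = sets (nonempty_subsets S) \<longrightarrow>
            sigma_finite_measure \<nu> \<longrightarrow>
            poisson_process M \<nu> J B \<longrightarrow>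
            downward_FKG S (covered_law S M J B))
       \<and> (\<exists>(S :: nat set) (\<nu> :: nat set measure) (M :: (nat \<Rightarrow> nat) measure)
            (J :: (nat \<Rightarrow> nat) \<Rightarrow> nat set) (B :: nat \<Rightarrow> (nat \<Rightarrow> nat) \<Rightarrow> nat set).
            countable S \<and>
            sets \<nu> = sets (nonempty_subsets S) \<and>
            sigma_finite_measure \<nu> \<and>
            poisson_process M \<nu> J B \<and>
            \<not> FKG S (covered_law S M J B))"
proof (rule conjI)
  show "\<forall>(S :: 'a set) (\<nu> :: 'a set measure) (M :: 'w measure)
      (J :: 'w \<Rightarrow> 'j set) (B :: 'j \<Rightarrow> 'w \<Rightarrow> 'a set).
      countable S \<longrightarrow> sets \<nu> = sets (nonempty_subsets S) \<longrightarrow> sigma_finite_measure \<nu> \<longrightarrow>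
      poisson_process M \<nu> J B \<longrightarrow> downward_FKG S (covered_law S M J B)"
    by (blast intro: random_cover.downward_FKG_covered_law[OF random_cover_if_poisson])
  show "\<exists>(S :: nat set) (\<nu> :: nat set measure) (M :: (nat \<Rightarrow> nat) measure)
      (J :: (nat \<Rightarrow> nat) \<Rightarrow> nat set) (B :: nat \<Rightarrow> (nat \<Rightarrow> nat) \<Rightarrow> nat set).
      countable S \<and> sets \<nu> = sets (nonempty_subsets S) \<and> sigma_finite_measure \<nu> \<and>
      poisson_process M \<nu> J B \<and> \<not> FKG S (covered_law S M J B)"
    using sets_edge_intensity finite_measure.sigma_finite_measure[OF finite_measure_edge_intensity]
      poisson_process_edges not_FKG_edges
    by (intro exI[of _ "{0, 1, 2}"] exI[of _ edge_intensity] exI[of _ "measure_pmf pair_law"]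
        exI[of _ edge_index] exI[of _ edge_point]) auto
qed

end
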